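(* Let $H$ be a hypergraph with a non-empty minimal edge cut $F$. Let $H_i$, for $i\in I$, denote the connected components of $H\setminus F$. Then $H$ has an Euler family $\mathcal{F}$ if and only if there exists $J\subseteq I$ with $1\leq |J|\leq |F|$ such that the following hold: (1) $H\big[\bigcup_{j\in J}V(H_j)\big]$ has a non-empty Euler family $\mathcal{F}_J$; and (2) $H_i$ has an Euler family $\mathcal{F}_i$ for all $i\in I\setminus J$. The same equivalence holds with "Euler family" replaced by "spanning Euler family" throughout (for $H$, in (1), and in (2)). Furthermore, the Euler families $\mathcal{F}$, $\mathcal{F}_J$, and each $\mathcal{F}_i$ ($i\in I\setminus J$) can be chosen so that they satisfy $|\mathcal{F}|=|\mathcal{F}_J|+\sum_{i\in I\setminus J}|\mathcal{F}_i|$.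
   Context: A hypergraph $H=(V,E)$ has a non-empty finite vertex set $V$ and a finite collection $E$ of edges, each associated with a subset of $V$; parallel edges are allowed, so $E$ is a multiset of subsets of $V$. A walk is a sequence $v_0e_1v_1\dots v_{r-1}e_rv_r$ ($r\ge 0$) with $v_{i-1}\ne v_i$ and $v_{i-1},v_i\in e_i$ for all $i=1,\dots,r$; its anchors are $v_0,\dots,v_r$; it is closed if $v_0=v_r$, trivial if $r=0$, and a strict trail if its edges are pairwise distinct. $H$ is connected if any two vertices are joined by a walk; the connected components of $H$ are its maximal connected subhypergraphs $(V',E')$ with $V'\subseteq V$, $E'\subseteq E$, having no empty edges. An Euler family of $H$ is a collection of pairwise edge-disjoint, pairwise anchor-disjoint non-trivial closed strict trails of $H$ jointly traversing every edge of $H$ exactly once (an edgeless hypergraph has the empty Euler family); it is spanning if every vertex of $H$ is an anchor of one of its trails. For $\emptyset\neq S\subsetneq V$, the set $[S,\overline S]=\{e\in E: e\cap S\neq\emptyset,\ e\cap\overline S\neq\emptyset\}$, with $\overline S=V\setminus S$, is an edge cut of $H$; an edge cut is minimal if it properly contains no edge cut of $H$. $H\setminus F=(V,E\setminus F)$. For $V'\subseteq V$, the induced subhypergraph $H[V']$ has vertex set $V'$ and edge multiset $\{e\cap V': e\in E,\ e\cap V'\neq\emptyset\}$ (one edge for each such $e$).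
   Formalization: The formal theorem assumes that H has no empty edges; with an empty edge the "if" direction fails (V={1,2}, two parallel edges {1,2} forming F, and one empty edge, which H[V] drops but no trail of H can traverse). *)

theory Defs imports Main begin

(* Edges are labels 'e carrying a vertex set, so parallel edges are distinct labels with the same
   vertex set, and cardinalities of edge sets count multiplicities. *)
record ('v, 'e) hypergraph =
  verts :: "'v set"
  edges :: "'e set"
  ends :: "'e \<Rightarrow> 'v set"

definition wf_hypergraph :: "('v, 'e) hypergraph \<Rightarrow> bool" where
  "wf_hypergraph H \<longleftrightarrow> finite (verts H) \<and> verts H \<noteq> {} \<and> finite (edges H) \<and>
     (\<forall>e\<in>edges H. ends H e \<subseteq> verts H)"

definition no_empty_edges :: "('v, 'e) hypergraph \<Rightarrow> bool" where
  "no_empty_edges H \<longleftrightarrow> (\<forall>e\<in>edges H. ends H e \<noteq> {})"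

(* The pair ([v_0, ..., v_r], [e_1, ..., e_r]) encodes v_0 e_1 v_1 ... e_r v_r. *)
type_synonym ('v, 'e) walk = "'v list \<times> 'e list"

definition anchors :: "('v, 'e) walk \<Rightarrow> 'v set" where
  "anchors w = set (fst w)"

definition walk_edges :: "('v, 'e) walk \<Rightarrow> 'e set" where
  "walk_edges w = set (snd w)"

definition is_walk :: "('v, 'e) hypergraph \<Rightarrow> ('v, 'e) walk \<Rightarrow> bool" where
  "is_walk H w \<longleftrightarrow>
     length (fst w) = Suc (length (snd w)) \<and> anchors w \<subseteq> verts H \<and> walk_edges w \<subseteq> edges H \<and>
     (\<forall>i<length (snd w). fst w ! i \<noteq> fst w ! Suc i \<and>
        fst w ! i \<in> ends H (snd w ! i) \<and> fst w ! Suc i \<in> ends H (snd w ! i))"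

definition closed_walk :: "('v, 'e) walk \<Rightarrow> bool" where
  "closed_walk w \<longleftrightarrow> hd (fst w) = last (fst w)"

definition trivial_walk :: "('v, 'e) walk \<Rightarrow> bool" where
  "trivial_walk w \<longleftrightarrow> snd w = []"

definition strict_trail :: "('v, 'e) hypergraph \<Rightarrow> ('v, 'e) walk \<Rightarrow> bool" where
  "strict_trail H w \<longleftrightarrow> is_walk H w \<and> distinct (snd w)"

definition connected_hypergraph :: "('v, 'e) hypergraph \<Rightarrow> bool" where
  "connected_hypergraph H \<longleftrightarrow>
     (\<forall>u\<in>verts H. \<forall>v\<in>verts H. \<exists>w. is_walk H w \<and> hd (fst w) = u \<and> last (fst w) = v)"

(* Well-formedness of the first argument makes its edges subsets of its own vertex set. The
   functions ends are required to agree everywhere, so that a subhypergraph is determined by its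
   vertex set and its edge set. *)
definition subhypergraph :: "('v, 'e) hypergraph \<Rightarrow> ('v, 'e) hypergraph \<Rightarrow> bool" where
  "subhypergraph H' H \<longleftrightarrow> wf_hypergraph H' \<and> verts H' \<subseteq> verts H \<and> edges H' \<subseteq> edges H \<and>
     ends H' = ends H"

definition components :: "('v, 'e) hypergraph \<Rightarrow> ('v, 'e) hypergraph set" where
  "components H =
     {C. subhypergraph C H \<and> connected_hypergraph C \<and> no_empty_edges C \<and>
         (\<forall>D. subhypergraph D H \<and> connected_hypergraph D \<and> no_empty_edges D \<and> subhypergraph C D
              \<longrightarrow> D = C)}"

definition euler_family :: "('v, 'e) hypergraph \<Rightarrow> ('v, 'e) walk set \<Rightarrow> bool" where
  "euler_family H T \<longleftrightarrow>
     (\<forall>t\<in>T. strict_trail H t \<and> closed_walk t \<and> \<not> trivial_walk t) \<and>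
     pairwise (\<lambda>s t. disjnt (walk_edges s) (walk_edges t)) T \<and>
     pairwise (\<lambda>s t. disjnt (anchors s) (anchors t)) T \<and>
     (\<Union>t\<in>T. walk_edges t) = edges H"

definition spanning_euler_family :: "('v, 'e) hypergraph \<Rightarrow> ('v, 'e) walk set \<Rightarrow> bool" where
  "spanning_euler_family H T \<longleftrightarrow> euler_family H T \<and> (\<forall>v\<in>verts H. \<exists>t\<in>T. v \<in> anchors t)"

definition cut :: "('v, 'e) hypergraph \<Rightarrow> 'v set \<Rightarrow> 'e set" where
  "cut H S = {e \<in> edges H. ends H e \<inter> S \<noteq> {} \<and> ends H e \<inter> (verts H - S) \<noteq> {}}"

definition edge_cut :: "('v, 'e) hypergraph \<Rightarrow> 'e set \<Rightarrow> bool" where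
  "edge_cut H F \<longleftrightarrow> (\<exists>S. S \<noteq> {} \<and> S \<subset> verts H \<and> F = cut H S)"

(* The empty set counts as an edge cut if H is disconnected. *)
definition minimal_edge_cut :: "('v, 'e) hypergraph \<Rightarrow> 'e set \<Rightarrow> bool" where
  "minimal_edge_cut H F \<longleftrightarrow> edge_cut H F \<and> \<not> (\<exists>F'. edge_cut H F' \<and> F' \<subset> F)"

definition delete_edges :: "('v, 'e) hypergraph \<Rightarrow> 'e set \<Rightarrow> ('v, 'e) hypergraph" where
  "delete_edges H F = H\<lparr>edges := edges H - F\<rparr>"

definition induced :: "('v, 'e) hypergraph \<Rightarrow> 'v set \<Rightarrow> ('v, 'e) hypergraph" where
  "induced H V' = \<lparr>verts = V', edges = {e \<in> edges H. ends H e \<inter> V' \<noteq> {}},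
                   ends = (\<lambda>e. ends H e \<inter> V')\<rparr>"

end

theory Submission imports Defs begin

text \<open>
  Since \<open>F\<close> is non-empty and minimal, it is the edge cut of every component: if \<open>K\<close> is the vertex
  set of a component of \<open>H \<setminus> F\<close>, an edge leaving \<open>K\<close> must belong to \<open>F\<close>, so the cut of \<open>K\<close> is
  contained in \<open>F\<close> and by minimality equals \<open>F\<close>. Hence every edge of \<open>F\<close> meets every component
  (\<open>cut_of_component\<close>). For any non-empty set \<open>J\<close> of components, the hypergraph induced on the union
  of \<open>J\<close> therefore carries precisely the edges of \<open>F\<close> and of the members of \<open>J\<close>, and together
  with the components outside \<open>J\<close> it partitions both the vertices and the edges of \<open>H\<close>
  (\<open>pieces_decomposition\<close>).

  For such a partition, Euler families of the parts unite to an Euler family of the whole, and an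
  Euler family of the whole whose trails each stay inside one part splits into Euler families of
  the parts; the number of trails is additive in both cases (\<open>glue\<close> and \<open>split\<close>).
  So gluing works for every non-empty \<open>J\<close>.

  In the other direction \<open>J\<close> has to be chosen such that all trails through \<open>F\<close> stay in the union of
  \<open>J\<close>. A trail of the given Euler family can enter a new component only along an edge of \<open>F\<close>, and
  each edge of \<open>F\<close> is traversed exactly once. Let \<open>J\<close> consist of the components in which the
  traversals of the edges of \<open>F\<close> arrive; then \<open>1 \<le> |J| \<le> |F|\<close>. Following a closed trail
  through an edge of \<open>F\<close> once around from the head of that edge, one never leaves the union of \<open>J\<close>,
  whereas a trail avoiding \<open>F\<close> lies in a single component.
\<close>

section \<open>Walks and components\<close>

definition adjacency :: "('v, 'e) hypergraph \<Rightarrow> ('v \<times> 'v) set" where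
  "adjacency G = {(u, v). \<exists>e\<in>edges G. u \<in> ends G e \<and> v \<in> ends G e}"

lemma sym_adjacency_rtrancl: "sym ((adjacency G)\<^sup>*)"
  by (rule sym_rtrancl) (auto simp: sym_def adjacency_def)

lemma adjacency_rtrancl_sym: "(u, v) \<in> (adjacency G)\<^sup>* \<Longrightarrow> (v, u) \<in> (adjacency G)\<^sup>*"
  using sym_adjacency_rtrancl by (rule symD)

lemma adjacency_mono:
  assumes "edges C \<subseteq> edges G" and "ends C = ends G"
  shows "(adjacency C)\<^sup>* \<subseteq> (adjacency G)\<^sup>*"
  using assms by (intro rtrancl_mono) (auto simp: adjacency_def)

lemma is_walk_nth_reachable:
  assumes "is_walk G w" and "i \<le> length (snd w)"
  shows "(hd (fst w), fst w ! i) \<in> (adjacency G)\<^sup>*"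
  using assms(2)
proof (induction i)
  case 0
  from assms(1) have "fst w \<noteq> []" by (auto simp: is_walk_def)
  then show ?case by (simp add: hd_conv_nth)
next
  case (Suc i)
  with assms(1) have "(fst w ! i, fst w ! Suc i) \<in> adjacency G"
    by (auto simp: is_walk_def adjacency_def walk_edges_def intro!: bexI[of _ "snd w ! i"])
  with Suc show ?case by (meson Suc_leD rtrancl.rtrancl_into_rtrancl)
qed

lemma is_walk_reachable:
  assumes "is_walk G w"
  shows "(hd (fst w), last (fst w)) \<in> (adjacency G)\<^sup>*"
proof -
  from assms have "last (fst w) = fst w ! length (snd w)"
    by (subst last_conv_nth) (auto simp: is_walk_def)
  with is_walk_nth_reachable[OF assms, of "length (snd w)"] show ?thesis by simp
qed

lemma is_walk_Cons:
  assumes "is_walk G w" and "e \<in> edges G" and "u \<in> ends G e" and "hd (fst w) \<in> ends G e"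
    and "u \<noteq> hd (fst w)" and "u \<in> verts G"
  shows "is_walk G (u # fst w, e # snd w)"
proof -
  from assms(1) have "fst w \<noteq> []" by (auto simp: is_walk_def)
  then have "hd (fst w) = fst w ! 0" by (simp add: hd_conv_nth)
  with assms show ?thesis
    by (auto simp: is_walk_def anchors_def walk_edges_def less_Suc_eq_0_disj)
qed

lemma reachable_imp_walk:
  assumes "wf_hypergraph G" and "v \<in> verts G" and "(u, v) \<in> (adjacency G)\<^sup>*"
  shows "\<exists>w. is_walk G w \<and> hd (fst w) = u \<and> last (fst w) = v"
  using assms(3)
proof (induction rule: converse_rtrancl_induct)
  case base
  from assms(2) have "is_walk G ([v], [])"
    by (simp add: is_walk_def anchors_def walk_edges_def)
  then show ?case by (intro exI[of _ "([v], [])"]) simp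
next
  case (step u y)
  then obtain w where w: "is_walk G w" "hd (fst w) = y" "last (fst w) = v" by blast
  show ?case
  proof (cases "u = y")
    case True
    with w show ?thesis by blast
  next
    case False
    from step.hyps(1) obtain e where e: "e \<in> edges G" "u \<in> ends G e" "y \<in> ends G e"
      by (auto simp: adjacency_def)
    with assms(1) have "u \<in> verts G" by (auto simp: wf_hypergraph_def)
    with w e False have "is_walk G (u # fst w, e # snd w)" by (simp add: is_walk_Cons)
    moreover from w(1) have "fst w \<noteq> []" by (auto simp: is_walk_def)
    ultimately show ?thesis using w(3) by (intro exI[of _ "(u # fst w, e # snd w)"]) simp
  qed
qed

lemma connected_hypergraph_iff_adjacency:
  assumes "wf_hypergraph G"
  shows "connected_hypergraph G \<longleftrightarrow> (\<forall>u\<in>verts G. \<forall>v\<in>verts G. (u, v) \<in> (adjacency G)\<^sup>*)"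
  unfolding connected_hypergraph_def
  using reachable_imp_walk[OF assms] is_walk_reachable by metis

definition component_at :: "('v, 'e) hypergraph \<Rightarrow> 'v \<Rightarrow> ('v, 'e) hypergraph" where
  "component_at G v =
    \<lparr>verts = {u. (v, u) \<in> (adjacency G)\<^sup>*},
     edges = {e \<in> edges G. ends G e \<inter> {u. (v, u) \<in> (adjacency G)\<^sup>*} \<noteq> {}},
     ends = ends G\<rparr>"

lemma component_at_simps [simp]:
  "u \<in> verts (component_at G v) \<longleftrightarrow> (v, u) \<in> (adjacency G)\<^sup>*"
  "edges (component_at G v) = {e \<in> edges G. ends G e \<inter> verts (component_at G v) \<noteq> {}}"
  "ends (component_at G v) = ends G"
  by (simp_all add: component_at_def)

lemma component_at_edge:
  assumes "e \<in> edges (component_at G v)"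
  shows "ends G e \<subseteq> verts (component_at G v)"
proof
  fix u assume u: "u \<in> ends G e"
  from assms obtain y where y: "e \<in> edges G" "y \<in> ends G e" "(v, y) \<in> (adjacency G)\<^sup>*" by auto
  with u have "(y, u) \<in> adjacency G" by (auto simp: adjacency_def)
  with y(3) show "u \<in> verts (component_at G v)" by simp
qed

lemma component_at_subset_verts:
  assumes "wf_hypergraph G" and "v \<in> verts G"
  shows "verts (component_at G v) \<subseteq> verts G"
proof
  fix u assume "u \<in> verts (component_at G v)"
  then have "(v, u) \<in> (adjacency G)\<^sup>*" by simp
  then show "u \<in> verts G"
    using assms by (induction rule: rtrancl_induct) (auto simp: adjacency_def wf_hypergraph_def)
qed

lemma subhypergraph_component_at:
  assumes "wf_hypergraph G" and "v \<in> verts G"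
  shows "subhypergraph (component_at G v) G"
proof -
  have sub: "verts (component_at G v) \<subseteq> verts G"
    using assms by (rule component_at_subset_verts)
  with assms(1) have fin: "finite (verts (component_at G v))" "finite (edges (component_at G v))"
    by (auto simp: wf_hypergraph_def intro: finite_subset)
  have "v \<in> verts (component_at G v)" by simp
  then have "verts (component_at G v) \<noteq> {}" by blast
  with fin have "wf_hypergraph (component_at G v)"
    using component_at_edge[of _ G v] by (simp add: wf_hypergraph_def)
  with sub show ?thesis by (auto simp: subhypergraph_def)
qed

lemma connected_component_at:
  assumes "wf_hypergraph G" and "v \<in> verts G"
  shows "connected_hypergraph (component_at G v)"
proof -
  let ?C = "component_at G v"
  have reach: "(v, u) \<in> (adjacency ?C)\<^sup>*" if "(v, u) \<in> (adjacency G)\<^sup>*" for u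
    using that
  proof (induction rule: rtrancl_induct)
    case (step y z)
    then obtain e where e: "e \<in> edges G" "y \<in> ends G e" "z \<in> ends G e"
      by (auto simp: adjacency_def)
    from step.hyps(1) have "y \<in> verts ?C" by simp
    with e have "e \<in> edges ?C" unfolding component_at_simps(2) by blast
    with e(2,3) have "(y, z) \<in> adjacency ?C"
      by (auto simp: adjacency_def simp del: component_at_simps(2))
    with step.IH show ?case by simp
  qed simp
  then have "(u, w) \<in> (adjacency ?C)\<^sup>*" if "u \<in> verts ?C" "w \<in> verts ?C" for u w
    using that adjacency_rtrancl_sym[OF reach] by (meson component_at_simps(1) rtrancl_trans)
  then show ?thesis
    using subhypergraph_component_at[OF assms]
    by (simp add: connected_hypergraph_iff_adjacency subhypergraph_def)
qed

lemma connected_subhypergraph_component_at: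
  assumes "subhypergraph D G" and "connected_hypergraph D" and "no_empty_edges D"
    and "wf_hypergraph G" and "v \<in> verts D"
  shows "subhypergraph D (component_at G v)"
proof -
  from assms(1) have D: "wf_hypergraph D" "edges D \<subseteq> edges G" "ends D = ends G"
    by (auto simp: subhypergraph_def)
  have "(v, u) \<in> (adjacency D)\<^sup>*" if "u \<in> verts D" for u
    using assms(2,5) that by (simp add: connected_hypergraph_iff_adjacency[OF D(1)])
  with adjacency_mono[OF D(2,3)] have "verts D \<subseteq> verts (component_at G v)"
    by (simp add: subset_iff)
  moreover from D assms(3) have "ends G e \<inter> verts D \<noteq> {}" if "e \<in> edges D" for e
    using that by (fastforce simp: no_empty_edges_def wf_hypergraph_def)
  ultimately show ?thesis
    using D by (fastforce simp: subhypergraph_def)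
qed

lemma subhypergraph_antisym:
  "subhypergraph C D \<Longrightarrow> subhypergraph D C \<Longrightarrow> C = (D :: ('v, 'e) hypergraph)"
  by (rule hypergraph.equality) (auto simp: subhypergraph_def)

text \<open>Reachability classes are connected, and every connected subhypergraph lies in the class of
  any of its vertices; so they are exactly the maximal connected subhypergraphs.\<close>

lemma components_eq_component_at:
  assumes "wf_hypergraph G" and "no_empty_edges G"
  shows "components G = component_at G ` verts G"
proof (intro equalityI subsetI)
  have at: "subhypergraph (component_at G v) G \<and> connected_hypergraph (component_at G v) \<and>
      no_empty_edges (component_at G v)" if "v \<in> verts G" for v
    using subhypergraph_component_at[OF assms(1) that] connected_component_at[OF assms(1) that]
      assms(2) by (simp add: no_empty_edges_def)
  {
    fix C assume "C \<in> components G"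
    then have C: "subhypergraph C G" "connected_hypergraph C" "no_empty_edges C"
      and max: "\<And>D. subhypergraph D G \<Longrightarrow> connected_hypergraph D \<Longrightarrow> no_empty_edges D \<Longrightarrow>
        subhypergraph C D \<Longrightarrow> D = C"
      by (auto simp: components_def)
    then obtain v where v: "v \<in> verts C" "v \<in> verts G"
      by (fastforce simp: subhypergraph_def wf_hypergraph_def)
    have "subhypergraph C (component_at G v)"
      using C assms(1) v(1) by (rule connected_subhypergraph_component_at)
    with max at[OF v(2)] have "component_at G v = C" by blast
    with v(2) show "C \<in> component_at G ` verts G" by blast
  next
    fix C assume "C \<in> component_at G ` verts G"
    then obtain v where v: "v \<in> verts G" "C = component_at G v" by blast
    have "D = C" if D: "subhypergraph D G" "connected_hypergraph D" "no_empty_edges D"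
      and CD: "subhypergraph C D" for D
    proof -
      have "v \<in> verts C" by (simp add: v(2))
      with CD have "v \<in> verts D" by (auto simp: subhypergraph_def)
      then have "subhypergraph D C"
        using connected_subhypergraph_component_at[OF D assms(1)] v(2) by blast
      then show ?thesis using CD by (rule subhypergraph_antisym)
    qed
    with at[OF v(1)] v(2) show "C \<in> components G" by (simp add: components_def)
  }
qed

lemma component_at_eqI:
  assumes "(u, v) \<in> (adjacency G)\<^sup>*"
  shows "component_at G u = component_at G v"
proof -
  have "{w. (u, w) \<in> (adjacency G)\<^sup>*} = {w. (v, w) \<in> (adjacency G)\<^sup>*}"
    using assms adjacency_rtrancl_sym[OF assms] by (auto intro: rtrancl_trans)
  then show ?thesis by (simp add: component_at_def)
qed

lemma component_at_unique:
  assumes "u \<in> verts (component_at G v)" and "u \<in> verts (component_at G w)"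
  shows "component_at G v = component_at G w"
  using assms component_at_eqI by (metis component_at_simps(1))

section \<open>Euler families of a hypergraph partitioned into pieces\<close>

lemma euler_family_trail_nonempty:
  assumes "euler_family G T" and "t \<in> T"
  shows "walk_edges t \<noteq> {}" and "anchors t \<noteq> {}"
  using assms
  by (auto simp: euler_family_def trivial_walk_def walk_edges_def strict_trail_def is_walk_def
      anchors_def)

lemma euler_family_edgeE:
  assumes "euler_family G T" and "e \<in> edges G"
  obtains t where "t \<in> T" "e \<in> walk_edges t"
proof -
  from assms have "e \<in> (\<Union>t\<in>T. walk_edges t)" by (simp add: euler_family_def)
  then show ?thesis using that by blast
qed

text \<open>Non-trivial edge-disjoint trails have distinct edge sets, so there are at most as many as
  subsets of the edge set. Without finiteness the cardinality of a family would say nothing.\<close>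

lemma finite_euler_family:
  assumes "euler_family G T" and "finite (edges G)"
  shows "finite T"
proof (rule inj_on_finite)
  show "inj_on walk_edges T"
  proof (rule inj_onI)
    fix s t assume st: "s \<in> T" "t \<in> T" "walk_edges s = walk_edges t"
    then have "\<not> disjnt (walk_edges s) (walk_edges t)"
      using euler_family_trail_nonempty(1)[OF assms(1)] by (auto simp: disjnt_def)
    with st assms(1) show "s = t" unfolding euler_family_def by (meson pairwiseD)
  qed
  show "walk_edges ` T \<subseteq> Pow (edges G)"
    using assms(1) by (auto simp: euler_family_def)
  show "finite (Pow (edges G))" using assms(2) by simp
qed

text \<open>A piece may carry only a part of the vertex set of an edge, since inducing on a vertex set
  shrinks the edges.\<close>

locale hypergraph_decomposition =
  fixes H :: "('v, 'e) hypergraph" and P :: "('v, 'e) hypergraph set"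
  assumes finite_edges: "finite (edges H)"
    and finite_pieces: "finite P"
    and verts_disjoint: "\<And>A B. A \<in> P \<Longrightarrow> B \<in> P \<Longrightarrow> A \<noteq> B \<Longrightarrow> verts A \<inter> verts B = {}"
    and edges_disjoint: "\<And>A B. A \<in> P \<Longrightarrow> B \<in> P \<Longrightarrow> A \<noteq> B \<Longrightarrow> edges A \<inter> edges B = {}"
    and verts_union: "(\<Union>A\<in>P. verts A) = verts H"
    and edges_union: "(\<Union>A\<in>P. edges A) = edges H"
    and ends_piece: "\<And>A e. A \<in> P \<Longrightarrow> e \<in> edges A \<Longrightarrow> ends A e = ends H e \<inter> verts A"
begin

lemma is_walk_piece:
  assumes "A \<in> P"
  shows "is_walk A t \<longleftrightarrow> is_walk H t \<and> anchors t \<subseteq> verts A \<and> walk_edges t \<subseteq> edges A"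
proof -
  have sub: "verts A \<subseteq> verts H" "edges A \<subseteq> edges H"
    using assms verts_union edges_union by auto
  show ?thesis
  proof (cases "length (fst t) = Suc (length (snd t)) \<and> anchors t \<subseteq> verts A \<and>
      walk_edges t \<subseteq> edges A")
    case True
    then have t: "fst t ! i \<in> verts A" "fst t ! Suc i \<in> verts A" "snd t ! i \<in> edges A"
      if "i < length (snd t)" for i
      using that by (auto simp: anchors_def walk_edges_def subset_iff)
    with True sub show ?thesis
      by (auto simp: is_walk_def ends_piece[OF assms])
  qed (auto simp: is_walk_def)
qed

lemma strict_trail_piece:
  "A \<in> P \<Longrightarrow>
    strict_trail A t \<longleftrightarrow> strict_trail H t \<and> anchors t \<subseteq> verts A \<and> walk_edges t \<subseteq> edges A"
  by (auto simp: strict_trail_def is_walk_piece)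

lemma edges_disjointD: "A \<in> P \<Longrightarrow> B \<in> P \<Longrightarrow> e \<in> edges A \<Longrightarrow> e \<in> edges B \<Longrightarrow> A = B"
  using edges_disjoint by blast

lemma verts_disjointD: "A \<in> P \<Longrightarrow> B \<in> P \<Longrightarrow> v \<in> verts A \<Longrightarrow> v \<in> verts B \<Longrightarrow> A = B"
  using verts_disjoint by blast

lemma finite_family_piece:
  assumes "A \<in> P" and "euler_family A T"
  shows "finite T"
  using assms finite_edges edges_union
  by (intro finite_euler_family[OF assms(2)]) (auto intro: finite_subset)

lemma card_union_of_families:
  assumes fam: "\<And>A. A \<in> P \<Longrightarrow> euler_family A (T A)"
  shows "card (\<Union>A\<in>P. T A) = (\<Sum>A\<in>P. card (T A))"
proof (rule card_UN_disjoint)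
  show "finite P" by (rule finite_pieces)
  show "\<forall>A\<in>P. finite (T A)" using finite_family_piece fam by blast
  show "\<forall>A\<in>P. \<forall>B\<in>P. A \<noteq> B \<longrightarrow> T A \<inter> T B = {}"
  proof (intro ballI impI)
    fix A B assume AB: "A \<in> P" "B \<in> P" "A \<noteq> B"
    have False if t: "t \<in> T A" "t \<in> T B" for t
    proof -
      obtain e where e: "e \<in> walk_edges t"
        using euler_family_trail_nonempty(1)[OF fam[OF AB(1)] t(1)] by blast
      have "e \<in> edges A" "e \<in> edges B"
        using fam[OF AB(1)] fam[OF AB(2)] t e by (auto simp: euler_family_def)
      with AB edges_disjointD show False by blast
    qed
    then show "T A \<inter> T B = {}" by blast
  qed
qed

lemma glue_euler:
  assumes fam: "\<And>A. A \<in> P \<Longrightarrow> euler_family A (T A)"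
  shows "euler_family H (\<Union>A\<in>P. T A)"
proof -
  have trail: "strict_trail H t \<and> closed_walk t \<and> \<not> trivial_walk t \<and>
      anchors t \<subseteq> verts A \<and> walk_edges t \<subseteq> edges A" if "A \<in> P" "t \<in> T A" for A t
    using fam[OF that(1)] that by (auto simp: euler_family_def strict_trail_piece)
  have disj: "disjnt (walk_edges s) (walk_edges t) \<and> disjnt (anchors s) (anchors t)"
    if s: "A \<in> P" "s \<in> T A" and t: "B \<in> P" "t \<in> T B" and "s \<noteq> t" for s t A B
  proof (cases "A = B")
    case True
    with t(2) have "t \<in> T A" by simp
    with fam[OF s(1)] s(2) \<open>s \<noteq> t\<close> show ?thesis
      by (simp add: euler_family_def pairwise_def)
  next
    case False
    with s(1) t(1) have "verts A \<inter> verts B = {}" "edges A \<inter> edges B = {}"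
      using verts_disjoint edges_disjoint by auto
    with trail[OF s] trail[OF t] show ?thesis by (auto simp: disjnt_def)
  qed
  have "(\<Union>t\<in>(\<Union>A\<in>P. T A). walk_edges t) = (\<Union>A\<in>P. \<Union>t\<in>T A. walk_edges t)" by blast
  also have "\<dots> = edges H"
    using fam by (simp add: euler_family_def edges_union)
  finally have "(\<Union>t\<in>(\<Union>A\<in>P. T A). walk_edges t) = edges H" .
  moreover have "\<forall>t\<in>(\<Union>A\<in>P. T A). strict_trail H t \<and> closed_walk t \<and> \<not> trivial_walk t"
    using trail by blast
  moreover have "pairwise (\<lambda>s t. disjnt (walk_edges s) (walk_edges t)) (\<Union>A\<in>P. T A)"
    "pairwise (\<lambda>s t. disjnt (anchors s) (anchors t)) (\<Union>A\<in>P. T A)"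
    by (intro pairwiseI; elim UN_E; simp add: disj)+
  ultimately show ?thesis unfolding euler_family_def by (intro conjI)
qed

text \<open>All edges of a piece are covered by trails inside that piece: the trail of the whole family
  through such an edge lies in some piece, and edge-disjointness leaves only one candidate.\<close>

lemma split_euler:
  assumes fam: "euler_family H T"
    and inside: "\<And>t. t \<in> T \<Longrightarrow> \<exists>A\<in>P. is_walk A t"
    and A: "A \<in> P"
  shows "euler_family A {t \<in> T. is_walk A t}"
proof -
  let ?T = "{t \<in> T. is_walk A t}"
  have "e \<in> (\<Union>t\<in>?T. walk_edges t)" if e: "e \<in> edges A" for e
  proof -
    from e A edges_union have "e \<in> edges H" by blast
    with fam obtain t where t: "t \<in> T" "e \<in> walk_edges t" by (rule euler_family_edgeE)
    with inside obtain B where B: "B \<in> P" "is_walk B t" by blast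
    with t(2) have "e \<in> edges B" by (auto simp: is_walk_def)
    with e A B(1) have "A = B" using edges_disjointD by blast
    with t B(2) show ?thesis by blast
  qed
  then have "(\<Union>t\<in>?T. walk_edges t) = edges A" by (auto simp: is_walk_def)
  with fam show ?thesis by (auto simp: euler_family_def pairwise_def strict_trail_def)
qed

lemma euler_spanning_cases:
  assumes "EF \<in> {euler_family, spanning_euler_family}"
  obtains "EF = euler_family" | "EF = spanning_euler_family"
  using assms by blast

text \<open>Gluing and splitting are stated for both kinds of families at once: that a family spans can be
  read off piece by piece, because each vertex belongs to exactly one piece.\<close>

lemma glue:
  assumes EF: "EF \<in> {euler_family, spanning_euler_family}"
    and fam: "\<And>A. A \<in> P \<Longrightarrow> EF A (T A)"
  shows "EF H (\<Union>A\<in>P. T A)" and "card (\<Union>A\<in>P. T A) = (\<Sum>A\<in>P. card (T A))"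
proof -
  from EF fam have fam': "euler_family A (T A)" if "A \<in> P" for A
    using that by (auto simp: spanning_euler_family_def)
  then show "card (\<Union>A\<in>P. T A) = (\<Sum>A\<in>P. card (T A))" by (rule card_union_of_families)
  have euler: "euler_family H (\<Union>A\<in>P. T A)" using fam' by (rule glue_euler)
  have spanning: "\<exists>t\<in>(\<Union>A\<in>P. T A). v \<in> anchors t"
    if "EF = spanning_euler_family" "v \<in> verts H" for v
  proof -
    from that(2) verts_union obtain A where A: "A \<in> P" "v \<in> verts A" by blast
    with fam[OF A(1)] that(1) obtain t where "t \<in> T A" "v \<in> anchors t"
      by (auto simp: spanning_euler_family_def)
    with A(1) show ?thesis by blast
  qed
  from EF show "EF H (\<Union>A\<in>P. T A)"
  proof (rule euler_spanning_cases)
    assume EF: "EF = spanning_euler_family"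
    with euler spanning have "spanning_euler_family H (\<Union>A\<in>P. T A)"
      by (simp add: spanning_euler_family_def)
    then show ?thesis unfolding EF .
  qed (simp add: euler)
qed

lemma split:
  assumes EF: "EF \<in> {euler_family, spanning_euler_family}"
    and fam: "EF H T"
    and inside: "\<And>t. t \<in> T \<Longrightarrow> \<exists>A\<in>P. is_walk A t"
  shows "A \<in> P \<Longrightarrow> EF A {t \<in> T. is_walk A t}"
    and "card T = (\<Sum>A\<in>P. card {t \<in> T. is_walk A t})"
proof -
  from EF fam have fam': "euler_family H T" by (auto simp: spanning_euler_family_def)
  have eul: "euler_family A {t \<in> T. is_walk A t}" if "A \<in> P" for A
    using fam' inside that by (rule split_euler)
  have "(\<Union>A\<in>P. {t \<in> T. is_walk A t}) = T" using inside by blast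
  with card_union_of_families[of "\<lambda>A. {t \<in> T. is_walk A t}", OF eul]
  show "card T = (\<Sum>A\<in>P. card {t \<in> T. is_walk A t})" by simp
  assume A: "A \<in> P"
  have spanning: "\<exists>t\<in>{t \<in> T. is_walk A t}. v \<in> anchors t"
    if "EF = spanning_euler_family" "v \<in> verts A" for v
  proof -
    from that(2) A verts_union have "v \<in> verts H" by blast
    moreover from that(1) fam have "\<forall>v\<in>verts H. \<exists>t\<in>T. v \<in> anchors t"
      by (simp add: spanning_euler_family_def)
    ultimately obtain t where t: "t \<in> T" "v \<in> anchors t" by blast
    with inside obtain B where B: "B \<in> P" "is_walk B t" by blast
    with t(2) have "v \<in> verts B" by (auto simp: is_walk_def)
    with that A B(1) have "A = B" using verts_disjointD by blast
    with t B(2) show ?thesis by blast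
  qed
  from EF show "EF A {t \<in> T. is_walk A t}"
  proof (rule euler_spanning_cases)
    assume EF: "EF = spanning_euler_family"
    with eul[OF A] spanning have "spanning_euler_family A {t \<in> T. is_walk A t}"
      by (simp add: spanning_euler_family_def)
    then show ?thesis unfolding EF .
  qed (simp add: eul[OF A])
qed

end

section \<open>The pieces determined by a minimal edge cut\<close>

locale nonempty_minimal_cut =
  fixes H :: "('v, 'e) hypergraph" and F :: "'e set"
  assumes wf: "wf_hypergraph H"
    and no_empty: "no_empty_edges H"
    and minimal: "minimal_edge_cut H F"
    and F_nonempty: "F \<noteq> {}"
begin

abbreviation G where "G \<equiv> delete_edges H F"

lemma G_simps [simp]: "verts G = verts H" "edges G = edges H - F" "ends G = ends H"
  by (simp_all add: delete_edges_def)

lemma wf_G: "wf_hypergraph G"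
  using wf by (simp add: wf_hypergraph_def)

lemma components_G: "components G = component_at G ` verts H"
  using components_eq_component_at[OF wf_G] no_empty by (simp add: no_empty_edges_def)

lemma finite_components: "finite (components G)"
  using wf by (simp add: components_G wf_hypergraph_def)

lemma F_subset: "F \<subseteq> edges H"
  using minimal by (auto simp: minimal_edge_cut_def edge_cut_def cut_def)

lemma component_verts: "C \<in> components G \<Longrightarrow> verts C \<subseteq> verts H"
  using component_at_subset_verts[OF wf_G] by (auto simp: components_G)

lemma component_verts_nonempty:
  assumes "C \<in> components G" shows "verts C \<noteq> {}"
proof -
  from assms obtain v where "C = component_at G v" by (auto simp: components_G)
  then have "v \<in> verts C" by simp
  then show ?thesis by blast
qed

lemma component_ends: "C \<in> components G \<Longrightarrow> ends C = ends H"
  by (auto simp: components_G)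

lemma component_edges:
  "C \<in> components G \<Longrightarrow> edges C = {e \<in> edges H - F. ends H e \<inter> verts C \<noteq> {}}"
  unfolding components_G by (elim imageE) simp

lemma component_edge_ends:
  "C \<in> components G \<Longrightarrow> e \<in> edges C \<Longrightarrow> ends H e \<subseteq> verts C"
  unfolding components_G using component_at_edge[of e G] by (metis G_simps(3) imageE)

lemma components_unique:
  "C \<in> components G \<Longrightarrow> D \<in> components G \<Longrightarrow> v \<in> verts C \<Longrightarrow> v \<in> verts D \<Longrightarrow> C = D"
  unfolding components_G by (auto intro: component_at_unique)

lemma component_exists:
  assumes "v \<in> verts H" shows "\<exists>C\<in>components G. v \<in> verts C"
proof -
  from assms have "component_at G v \<in> components G" by (simp add: components_G)
  then show ?thesis by (rule bexI[rotated]) simp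
qed

text \<open>The edges surviving in \<open>H \<setminus> F\<close> do not cross the vertex partition that defines \<open>F\<close>, so a
  component lies on one side of it.\<close>

lemma component_verts_proper:
  assumes "C \<in> components G" shows "verts C \<subset> verts H"
proof -
  from minimal obtain S where S: "S \<noteq> {}" "S \<subset> verts H" "F = cut H S"
    unfolding minimal_edge_cut_def edge_cut_def by blast
  from assms obtain v where v: "v \<in> verts H" "C = component_at G v"
    by (auto simp: components_G)
  have side: "u \<in> S \<longleftrightarrow> v \<in> S" if "(v, u) \<in> (adjacency G)\<^sup>*" for u
    using that
  proof (induction rule: rtrancl_induct)
    case (step y z)
    then obtain e where e: "e \<in> edges H" "e \<notin> F" "y \<in> ends H e" "z \<in> ends H e"
      by (auto simp: adjacency_def)
    then have "ends H e \<subseteq> verts H" using wf by (simp add: wf_hypergraph_def)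
    with e have "y \<in> S \<longleftrightarrow> z \<in> S" unfolding S(3) cut_def by blast
    with step.IH show ?case by simp
  qed simp
  have "verts C \<subseteq> S \<or> verts C \<subseteq> - S"
  proof (cases "v \<in> S")
    case True
    with side have "verts C \<subseteq> S" unfolding v(2) subset_iff component_at_simps by blast
    then show ?thesis ..
  next
    case False
    with side have "verts C \<subseteq> - S" unfolding v(2) subset_iff component_at_simps by blast
    then show ?thesis ..
  qed
  with S(1,2) have "verts C \<noteq> verts H" by blast
  with component_verts[OF assms] show ?thesis by blast
qed

text \<open>Edges leaving a component were deleted, so its cut is contained in \<open>F\<close>; minimality forces
  equality.\<close>

lemma cut_of_component:
  assumes "C \<in> components G" shows "cut H (verts C) = F"
proof -
  have "edge_cut H (cut H (verts C))"
    unfolding edge_cut_def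
    using component_verts_nonempty[OF assms] component_verts_proper[OF assms]
    by (intro exI[of _ "verts C"]) simp
  moreover have "cut H (verts C) \<subseteq> F"
  proof (rule subsetI, rule ccontr)
    fix e assume e: "e \<in> cut H (verts C)" "e \<notin> F"
    then have "e \<in> edges C" by (simp add: component_edges[OF assms] cut_def)
    with e(1) component_edge_ends[OF assms] show False by (auto simp: cut_def)
  qed
  ultimately show ?thesis
    using minimal by (auto simp: minimal_edge_cut_def psubset_eq)
qed

lemma F_meets_component:
  "C \<in> components G \<Longrightarrow> f \<in> F \<Longrightarrow> ends H f \<inter> verts C \<noteq> {}"
  using cut_of_component by (fastforce simp: cut_def)

abbreviation joined :: "('v, 'e) hypergraph set \<Rightarrow> ('v, 'e) hypergraph" where
  "joined J \<equiv> induced H (\<Union>C\<in>J. verts C)"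

lemma joined_simps [simp]:
  "verts (joined J) = (\<Union>C\<in>J. verts C)"
  "ends (joined J) e = ends H e \<inter> (\<Union>C\<in>J. verts C)"
  by (simp_all add: induced_def)

lemma joined_edges:
  assumes "J \<subseteq> components G" and "J \<noteq> {}"
  shows "edges (joined J) = F \<union> (\<Union>C\<in>J. edges C)"
proof -
  let ?V = "\<Union>C\<in>J. verts C"
  have meets: "ends H f \<inter> ?V \<noteq> {}" if "f \<in> F" for f
  proof -
    from assms obtain C where "C \<in> J" "C \<in> components G" by blast
    with F_meets_component[OF this(2) that] show ?thesis by blast
  qed
  have kept: "e \<in> (\<Union>C\<in>J. edges C) \<longleftrightarrow> e \<in> edges H - F \<and> ends H e \<inter> ?V \<noteq> {}" for e
  proof -
    have "e \<in> edges C \<longleftrightarrow> e \<in> edges H - F \<and> ends H e \<inter> verts C \<noteq> {}" if "C \<in> J" for C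
      using component_edges[of C] assms(1) that by (simp add: subset_iff)
    then show ?thesis by auto
  qed
  have joined: "e \<in> edges (joined J) \<longleftrightarrow> e \<in> edges H \<and> ends H e \<inter> ?V \<noteq> {}" for e
    by (simp add: induced_def)
  show ?thesis
  proof (rule set_eqI)
    fix e
    show "e \<in> edges (joined J) \<longleftrightarrow> e \<in> F \<union> (\<Union>C\<in>J. edges C)"
    proof (cases "e \<in> F")
      case True
      with F_subset meets[OF True] show ?thesis by (simp only: joined Un_iff subset_iff) simp
    next
      case False
      then show ?thesis by (simp only: joined kept Un_iff Diff_iff) simp
    qed
  qed
qed

lemma joined_notin_rest:
  assumes "J \<subseteq> components G" and "J \<noteq> {}"
  shows "joined J \<notin> components G - J"
proof
  assume rest: "joined J \<in> components G - J"
  from assms obtain C where C: "C \<in> J" "C \<in> components G" by blast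
  with component_verts_nonempty obtain v where v: "v \<in> verts C" by blast
  with C(1) have "v \<in> verts (joined J)" by auto
  with v C(2) rest have "joined J = C" by (intro components_unique[of _ C v]) simp_all
  with C(1) rest show False by simp
qed

lemma pieces_decomposition:
  assumes "J \<subseteq> components G" and "J \<noteq> {}"
  shows "hypergraph_decomposition H (insert (joined J) (components G - J))"
proof
  let ?R = "components G - J"
  have rest_disjoint: "verts (joined J) \<inter> verts C = {}" "edges (joined J) \<inter> edges C = {}"
    if C: "C \<in> ?R" for C
  proof -
    show verts: "verts (joined J) \<inter> verts C = {}"
      using C assms(1) components_unique by fastforce
    have "ends H e \<subseteq> verts C" "e \<notin> F" if "e \<in> edges C" for e
      using C that component_edges component_edge_ends by auto
    with verts show "edges (joined J) \<inter> edges C = {}"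
      by (fastforce simp: induced_def)
  qed
  have comp_disjoint: "verts C \<inter> verts D = {}" "edges C \<inter> edges D = {}"
    if "C \<in> components G" "D \<in> components G" "C \<noteq> D" for C D
  proof -
    show verts: "verts C \<inter> verts D = {}" using that components_unique by blast
    have "ends H e \<inter> verts D \<noteq> {}" if "e \<in> edges D" for e
      using that \<open>D \<in> components G\<close> component_edges by auto
    with verts show "edges C \<inter> edges D = {}"
      using component_edge_ends[OF that(1)] by blast
  qed
  fix A B assume A: "A \<in> insert (joined J) ?R"
  {
    assume B: "B \<in> insert (joined J) ?R" and "A \<noteq> B"
    with A consider "A = joined J" "B \<in> ?R" | "B = joined J" "A \<in> ?R" | "A \<in> ?R" "B \<in> ?R"
      by blast
    then have "verts A \<inter> verts B = {} \<and> edges A \<inter> edges B = {}"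
      by cases (use rest_disjoint comp_disjoint \<open>A \<noteq> B\<close> in blast)+
    then show "verts A \<inter> verts B = {}" "edges A \<inter> edges B = {}" by auto
  next
    fix e assume e: "e \<in> edges A"
    show "ends A e = ends H e \<inter> verts A"
    proof (cases "A = joined J")
      case False
      with A have "A \<in> components G" by simp
      with component_ends component_edge_ends[OF this e] show ?thesis by (simp add: Int_absorb2)
    qed simp
  }
next
  show "finite (edges H)" using wf by (simp add: wf_hypergraph_def)
  show "finite (insert (joined J) (components G - J))" using finite_components by simp
  have "(\<Union>A\<in>insert (joined J) (components G - J). verts A) = (\<Union>C\<in>components G. verts C)"
    using assms(1) by auto
  also have "\<dots> = verts H" using component_verts component_exists by blast
  finally show "(\<Union>A\<in>insert (joined J) (components G - J). verts A) = verts H" .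
  have "(\<Union>A\<in>insert (joined J) (components G - J). edges A) = F \<union> (\<Union>C\<in>components G. edges C)"
    using assms(1) by (auto simp: joined_edges[OF assms])
  also have "\<dots> = edges H"
  proof (intro equalityI subsetI)
    fix e assume e: "e \<in> edges H"
    show "e \<in> F \<union> (\<Union>C\<in>components G. edges C)"
    proof (cases "e \<in> F")
      case False
      from e no_empty wf obtain v where v: "v \<in> ends H e" "v \<in> verts H"
        by (fastforce simp: no_empty_edges_def wf_hypergraph_def)
      with component_exists obtain C where "C \<in> components G" "v \<in> verts C" by blast
      with e v(1) False show ?thesis by (auto simp: component_edges)
    qed simp
  qed (use F_subset component_edges in auto)
  finally show "(\<Union>A\<in>insert (joined J) (components G - J). edges A) = edges H" .
qed

lemma sum_pieces:
  fixes g :: "('v, 'e) hypergraph \<Rightarrow> nat"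
  assumes "J \<subseteq> components G" and "J \<noteq> {}"
  shows "(\<Sum>A\<in>insert (joined J) (components G - J). g A) =
    g (joined J) + (\<Sum>C\<in>components G - J. g C)"
  using joined_notin_rest[OF assms] finite_components by simp

section \<open>Choosing the components that the cut edges join\<close>

lemma walk_step_in_component:
  assumes "is_walk H t" and "i < length (snd t)" and "snd t ! i \<notin> F" and "C \<in> components G"
    and "fst t ! i \<in> verts C"
  shows "fst t ! Suc i \<in> verts C" and "snd t ! i \<in> edges C"
proof -
  from assms have e: "snd t ! i \<in> edges H - F" "fst t ! i \<in> ends H (snd t ! i)"
    "fst t ! Suc i \<in> ends H (snd t ! i)"
    by (auto simp: is_walk_def walk_edges_def)
  with assms show edge: "snd t ! i \<in> edges C" by (auto simp: component_edges)
  with e(3) component_edge_ends[OF assms(4)] show "fst t ! Suc i \<in> verts C" by blast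
qed

lemma walk_avoiding_cut_in_component:
  assumes "is_walk H t" and "walk_edges t \<inter> F = {}"
  shows "\<exists>C\<in>components G. anchors t \<subseteq> verts C \<and> walk_edges t \<subseteq> edges C"
proof -
  have len: "length (fst t) = Suc (length (snd t))" and "anchors t \<subseteq> verts H"
    using assms(1) by (auto simp: is_walk_def)
  then have "fst t ! 0 \<in> verts H" by (auto simp: anchors_def)
  then obtain C where C: "C \<in> components G" "fst t ! 0 \<in> verts C"
    using component_exists by blast
  have avoid: "snd t ! i \<notin> F" if "i < length (snd t)" for i
    using nth_mem[OF that] assms(2) by (auto simp: walk_edges_def)
  have v: "fst t ! i \<in> verts C" if "i \<le> length (snd t)" for i
    using that
  proof (induction i)
    case (Suc i)
    then show ?case using walk_step_in_component(1)[OF assms(1) _ avoid C(1)] by simp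
  qed (rule C(2))
  have "anchors t \<subseteq> verts C"
    using v len by (auto simp: anchors_def in_set_conv_nth)
  moreover have "walk_edges t \<subseteq> edges C"
    using v walk_step_in_component(2)[OF assms(1) _ avoid C(1)]
    by (auto simp: walk_edges_def in_set_conv_nth)
  ultimately show ?thesis using C(1) by blast
qed

text \<open>Membership in the union of \<open>J\<close> propagates forward along the trail: an edge of \<open>F\<close> arrives
  there by hypothesis, and any other edge stays in its component. So it propagates from the head of
  an edge of \<open>F\<close> to the end of the trail, which is also the start, and from there to every
  anchor.\<close>

lemma closed_walk_through_cut_in_joined:
  assumes t: "is_walk H t" "closed_walk t" and J: "J \<subseteq> components G"
    and arrive: "\<And>i. i < length (snd t) \<Longrightarrow> snd t ! i \<in> F \<Longrightarrow>
      fst t ! Suc i \<in> (\<Union>C\<in>J. verts C)"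
    and "walk_edges t \<inter> F \<noteq> {}"
  shows "anchors t \<subseteq> (\<Union>C\<in>J. verts C)"
proof -
  let ?V = "\<Union>C\<in>J. verts C" and ?r = "length (snd t)"
  have len: "length (fst t) = Suc ?r" using t(1) by (auto simp: is_walk_def)
  have advance: "fst t ! Suc i \<in> ?V" if "i < ?r" "fst t ! i \<in> ?V" for i
  proof (cases "snd t ! i \<in> F")
    case False
    from that(2) J obtain C where "C \<in> J" "C \<in> components G" "fst t ! i \<in> verts C" by blast
    with walk_step_in_component(1)[OF t(1) that(1) False] show ?thesis by blast
  qed (use arrive that in blast)
  have forward: "fst t ! k \<in> ?V" if "j \<le> k" "k \<le> ?r" "fst t ! j \<in> ?V" for j k
    using that
  proof (induction k rule: dec_induct)
    case (step n)
    then have "n < ?r" "fst t ! n \<in> ?V" by simp_all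
    then show ?case by (rule advance)
  qed
  from assms(5) obtain i where i: "i < ?r" "snd t ! i \<in> F"
    by (auto simp: walk_edges_def in_set_conv_nth)
  then have "fst t ! ?r \<in> ?V" using forward[of "Suc i" ?r] arrive by simp
  moreover have "fst t ! 0 = fst t ! ?r"
  proof -
    from len have "fst t \<noteq> []" by auto
    with t(2) len show ?thesis by (simp add: closed_walk_def hd_conv_nth last_conv_nth)
  qed
  ultimately have "fst t ! k \<in> ?V" if "k \<le> ?r" for k
    using forward[of 0 k] that by simp
  with len show ?thesis by (auto simp: anchors_def in_set_conv_nth less_Suc_eq_le simp del: UN_iff)
qed

text \<open>Each edge of \<open>F\<close> is traversed exactly once, so its traversal has a well-defined head; the set
  \<open>J\<close> is the image of \<open>F\<close> under taking the component of the head.\<close>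

lemma euler_family_cut_components:
  assumes fam: "euler_family H T"
  obtains J where "J \<subseteq> components G" "J \<noteq> {}" "card J \<le> card F"
    "\<And>t. t \<in> T \<Longrightarrow> \<exists>A\<in>insert (joined J) (components G - J). is_walk A t"
    "\<exists>t\<in>T. is_walk (joined J) t"
proof -
  have trail: "is_walk H t" "distinct (snd t)" "closed_walk t" if "t \<in> T" for t
    using fam that by (auto simp: euler_family_def strict_trail_def)
  have "pairwise (\<lambda>s t. disjnt (walk_edges s) (walk_edges t)) T"
    using fam by (simp add: euler_family_def)
  then have once: "s = t" if "s \<in> T" "t \<in> T" "e \<in> walk_edges s" "e \<in> walk_edges t" for s t e
    using that pairwiseD[of _ T s t] by (auto simp: disjnt_iff)
  have traversed: "\<exists>t\<in>T. f \<in> walk_edges t" if "f \<in> F" for f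
  proof -
    from that F_subset have "f \<in> edges H" by blast
    with fam obtain t where "t \<in> T" "f \<in> walk_edges t" by (rule euler_family_edgeE)
    then show ?thesis by blast
  qed
  \<comment> \<open>The pair \<open>p\<close> locates the traversal of \<open>f\<close>: a trail and a position in its edge list.\<close>
  have "\<forall>f\<in>F. \<exists>p. fst p \<in> T \<and> snd p < length (snd (fst p)) \<and> snd (fst p) ! snd p = f"
  proof
    fix f assume "f \<in> F"
    with traversed obtain t where "t \<in> T" "f \<in> walk_edges t" by blast
    moreover from this obtain i where "i < length (snd t)" "snd t ! i = f"
      by (auto simp: walk_edges_def in_set_conv_nth)
    ultimately show "\<exists>p. fst p \<in> T \<and> snd p < length (snd (fst p)) \<and> snd (fst p) ! snd p = f"
      by (intro exI[of _ "(t, i)"]) simp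
  qed
  then obtain p where "\<forall>f\<in>F. fst (p f) \<in> T \<and> snd (p f) < length (snd (fst (p f))) \<and>
      snd (fst (p f)) ! snd (p f) = f"
    by (rule bchoice[THEN exE])
  then have p: "fst (p f) \<in> T" "snd (p f) < length (snd (fst (p f)))"
    "snd (fst (p f)) ! snd (p f) = f" if "f \<in> F" for f
    using that by auto
  define head where "head f = fst (fst (p f)) ! Suc (snd (p f))" for f
  have head: "head (snd t ! i) = fst t ! Suc i"
    if "t \<in> T" "i < length (snd t)" "snd t ! i \<in> F" for t i
  proof -
    let ?f = "snd t ! i"
    have f1: "?f \<in> walk_edges t" using that(2) by (simp add: walk_edges_def)
    have f2: "?f \<in> walk_edges (fst (p ?f))"
      using nth_mem[OF p(2)[OF that(3)]] p(3)[OF that(3)] by (simp add: walk_edges_def)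
    have t: "fst (p ?f) = t" by (rule once[OF p(1)[OF that(3)] that(1) f2 f1])
    have "snd (p ?f) < length (snd t)" "snd t ! snd (p ?f) = ?f"
      using p(2,3)[OF that(3)] unfolding t by simp_all
    then have "snd (p ?f) = i"
      using nth_eq_iff_index_eq[OF trail(2)[OF that(1)] _ that(2)] by blast
    with t show ?thesis by (simp add: head_def)
  qed
  have head_verts: "head f \<in> verts H" if "f \<in> F" for f
  proof -
    have w: "is_walk H (fst (p f))" by (rule trail(1)[OF p(1)[OF that]])
    then have "head f \<in> anchors (fst (p f))"
      unfolding head_def anchors_def using p(2)[OF that] by (intro nth_mem) (simp add: is_walk_def)
    with w show ?thesis by (auto simp: is_walk_def)
  qed
  define J where "J = (\<lambda>f. component_at G (head f)) ` F"
  have J: "J \<subseteq> components G" 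
    unfolding J_def components_G by (intro image_subsetI imageI head_verts)
  have J_ne: "J \<noteq> {}" using F_nonempty by (simp add: J_def)
  interpret hypergraph_decomposition H "insert (joined J) (components G - J)"
    using J J_ne by (rule pieces_decomposition)
  have arrive: "fst t ! Suc i \<in> (\<Union>C\<in>J. verts C)"
    if "t \<in> T" "i < length (snd t)" "snd t ! i \<in> F" for t i
  proof -
    show ?thesis unfolding head[OF that, symmetric] J_def
      by (rule UN_I[OF imageI[OF that(3)]]) simp
  qed
  have in_joined: "is_walk (joined J) t"
    if t: "t \<in> T" and V: "anchors t \<subseteq> (\<Union>C\<in>J. verts C)" for t
  proof -
    have "snd t ! i \<in> edges (joined J)" if i: "i < length (snd t)" for i
    proof -
      from trail(1)[OF t] i have "snd t ! i \<in> edges H" "fst t ! i \<in> ends H (snd t ! i)"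
        "fst t ! i \<in> anchors t"
        by (auto simp: is_walk_def walk_edges_def anchors_def)
      moreover from this V have "ends H (snd t ! i) \<inter> (\<Union>C\<in>J. verts C) \<noteq> {}" by blast
      ultimately show ?thesis by (simp add: induced_def)
    qed
    then have "walk_edges t \<subseteq> edges (joined J)"
      by (auto simp: walk_edges_def in_set_conv_nth)
    with trail(1)[OF t] V show ?thesis by (simp add: is_walk_piece)
  qed
  have through: "is_walk (joined J) t" if t: "t \<in> T" and F: "walk_edges t \<inter> F \<noteq> {}" for t
    using t closed_walk_through_cut_in_joined[OF trail(1,3)[OF t] J arrive[OF t] F]
    by (rule in_joined)
  show ?thesis
  proof
    show "J \<subseteq> components G" "J \<noteq> {}" by fact+
    show "card J \<le> card F"
      using F_subset wf unfolding J_def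
      by (intro card_image_le) (auto simp: wf_hypergraph_def intro: finite_subset)
    obtain f where "f \<in> F" using F_nonempty by blast
    with traversed obtain t where "t \<in> T" "f \<in> walk_edges t" by blast
    with \<open>f \<in> F\<close> through show "\<exists>t\<in>T. is_walk (joined J) t" by blast
    fix t assume t: "t \<in> T"
    show "\<exists>A\<in>insert (joined J) (components G - J). is_walk A t"
    proof (cases "walk_edges t \<inter> F = {}")
      case True
      with walk_avoiding_cut_in_component[OF trail(1)[OF t]] obtain C
        where C: "C \<in> components G" "anchors t \<subseteq> verts C" "walk_edges t \<subseteq> edges C" by blast
      show ?thesis
      proof (cases "C \<in> J")
        case True
        with C(2) have "is_walk (joined J) t" by (intro in_joined t) blast
        then show ?thesis by blast
      next
        case False
        with C trail(1)[OF t] have "is_walk C t" by (simp add: is_walk_piece)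
        with C(1) False show ?thesis by blast
      qed
    qed (use through t in blast)
  qed
qed

lemma family_splits:
  assumes EF: "EF \<in> {euler_family, spanning_euler_family}" and fam: "EF H T"
  shows "\<exists>J \<subseteq> components G. 1 \<le> card J \<and> card J \<le> card F \<and>
    (\<exists>TJ TC. TJ \<noteq> {} \<and> EF (joined J) TJ \<and>
      (\<forall>C \<in> components G - J. EF C (TC C)) \<and>
      card T = card TJ + (\<Sum>C \<in> components G - J. card (TC C)))"
proof -
  from EF fam have "euler_family H T" by (auto simp: spanning_euler_family_def)
  then obtain J where J: "J \<subseteq> components G" "J \<noteq> {}" "card J \<le> card F"
    and inside: "\<And>t. t \<in> T \<Longrightarrow> \<exists>A\<in>insert (joined J) (components G - J). is_walk A t"
    and ne: "\<exists>t\<in>T. is_walk (joined J) t"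
    by (rule euler_family_cut_components) (rule that)
  interpret hypergraph_decomposition H "insert (joined J) (components G - J)"
    using J(1,2) by (rule pieces_decomposition)
  from J finite_components have "1 \<le> card J"
    by (simp add: Suc_le_eq card_gt_0_iff finite_subset)
  moreover have "{t \<in> T. is_walk (joined J) t} \<noteq> {}" using ne by blast
  moreover have "EF (joined J) {t \<in> T. is_walk (joined J) t}"
    "\<forall>C\<in>components G - J. EF C {t \<in> T. is_walk C t}"
    by (simp_all add: split(1)[OF EF fam inside])
  moreover have "card T = card {t \<in> T. is_walk (joined J) t} +
      (\<Sum>C \<in> components G - J. card {t \<in> T. is_walk C t})"
    using split(2)[OF EF fam inside] sum_pieces[OF J(1,2)] by simp
  ultimately have "\<exists>TJ TC. TJ \<noteq> {} \<and> EF (joined J) TJ \<and>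
      (\<forall>C \<in> components G - J. EF C (TC C)) \<and>
      card T = card TJ + (\<Sum>C \<in> components G - J. card (TC C))"
    by (intro exI[of _ "{t \<in> T. is_walk (joined J) t}"] exI[of _ "\<lambda>C. {t \<in> T. is_walk C t}"] conjI)
  with \<open>1 \<le> card J\<close> J(1,3) show ?thesis by (intro exI[of _ J] conjI)
qed

lemma families_glue:
  assumes EF: "EF \<in> {euler_family, spanning_euler_family}"
    and J: "J \<subseteq> components G" "J \<noteq> {}"
    and TJ: "EF (joined J) TJ" and TC: "\<forall>C \<in> components G - J. EF C (TC C)"
  shows "\<exists>T. EF H T \<and> card T = card TJ + (\<Sum>C \<in> components G - J. card (TC C))"
proof -
  interpret hypergraph_decomposition H "insert (joined J) (components G - J)"
    using J by (rule pieces_decomposition)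
  \<comment> \<open>Overriding at the joined piece loses no family, as it is not one of the remaining components.\<close>
  define T where "T = TC(joined J := TJ)"
  have T: "T (joined J) = TJ" "\<And>C. C \<in> components G - J \<Longrightarrow> T C = TC C"
    using joined_notin_rest[OF J] by (auto simp: T_def)
  have "EF A (T A)" if "A \<in> insert (joined J) (components G - J)" for A
    using that T TJ TC by auto
  from glue[OF EF this] sum_pieces[OF J, of "\<lambda>A. card (T A)"] show ?thesis
    using T by (intro exI conjI) (assumption, simp)
qed

end

theorem theorem7p4p3:
  fixes H :: "('v, 'e) hypergraph" and F :: "'e set"
  assumes "wf_hypergraph H"
    and "no_empty_edges H"
    and "minimal_edge_cut H F"
    and "F \<noteq> {}"
  shows "\<forall>EF \<in> {euler_family, spanning_euler_family}.
    ((\<exists>T. EF H T) \<longleftrightarrow>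
      (\<exists>J \<subseteq> components (delete_edges H F). 1 \<le> card J \<and> card J \<le> card F \<and>
        (\<exists>TJ. TJ \<noteq> {} \<and> EF (induced H (\<Union>C\<in>J. verts C)) TJ) \<and>
        (\<forall>C \<in> components (delete_edges H F) - J. \<exists>TC. EF C TC))) \<and>
    (\<forall>T. EF H T \<longrightarrow>
      (\<exists>J \<subseteq> components (delete_edges H F). 1 \<le> card J \<and> card J \<le> card F \<and>
        (\<exists>TJ TC. TJ \<noteq> {} \<and> EF (induced H (\<Union>C\<in>J. verts C)) TJ \<and>
          (\<forall>C \<in> components (delete_edges H F) - J. EF C (TC C)) \<and>
          card T = card TJ + (\<Sum>C \<in> components (delete_edges H F) - J. card (TC C))))) \<and>
    (\<forall>J \<subseteq> components (delete_edges H F). \<forall>TJ TC.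
      1 \<le> card J \<and> card J \<le> card F \<and>
      TJ \<noteq> {} \<and> EF (induced H (\<Union>C\<in>J. verts C)) TJ \<and>
      (\<forall>C \<in> components (delete_edges H F) - J. EF C (TC C)) \<longrightarrow>
      (\<exists>T. EF H T \<and>
        card T = card TJ + (\<Sum>C \<in> components (delete_edges H F) - J. card (TC C))))"
proof
  fix EF :: "('v, 'e) hypergraph \<Rightarrow> ('v, 'e) walk set \<Rightarrow> bool"
  assume EF: "EF \<in> {euler_family, spanning_euler_family}"
  interpret nonempty_minimal_cut H F using assms by unfold_locales
  have nonempty: "J \<noteq> {}" if "1 \<le> card J" for J :: "('v, 'e) hypergraph set"
    using that by auto
  note splits = family_splits[OF EF]
  have glues: "\<exists>T. EF H T \<and> card T = card TJ + (\<Sum>C \<in> components G - J. card (TC C))"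
    if "J \<subseteq> components G" "1 \<le> card J" "EF (joined J) TJ" "\<forall>C \<in> components G - J. EF C (TC C)"
    for J TJ TC
    using families_glue[OF EF that(1) nonempty[OF that(2)] that(3,4)] .
  have iff: "(\<exists>T. EF H T) \<longleftrightarrow>
      (\<exists>J \<subseteq> components G. 1 \<le> card J \<and> card J \<le> card F \<and>
        (\<exists>TJ. TJ \<noteq> {} \<and> EF (joined J) TJ) \<and>
        (\<forall>C \<in> components G - J. \<exists>TC. EF C TC))" (is "?L \<longleftrightarrow> ?R")
  proof
    assume ?L
    then obtain T where "EF H T" by (rule exE)
    from splits[OF this] obtain J TJ TC where J: "J \<subseteq> components G" "1 \<le> card J" "card J \<le> card F"
      and TJ: "TJ \<noteq> {}" "EF (joined J) TJ" and TC: "\<forall>C \<in> components G - J. EF C (TC C)"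
      by (elim exE conjE)
    have "\<exists>TJ. TJ \<noteq> {} \<and> EF (joined J) TJ" using TJ by (intro exI[of _ TJ] conjI)
    moreover have "\<forall>C \<in> components G - J. \<exists>TC. EF C TC"
      by (intro ballI exI) (rule bspec[OF TC])
    ultimately show ?R using J by (intro exI[of _ J] conjI)
  next
    assume ?R
    then obtain J TJ where J: "J \<subseteq> components G" "1 \<le> card J" "EF (joined J) TJ"
      and "\<forall>C \<in> components G - J. \<exists>TC. EF C TC"
      by (elim exE conjE)
    from bchoice[OF this(4)] obtain TC where "\<forall>C \<in> components G - J. EF C (TC C)"
      by (rule exE)
    from glues[OF J this] obtain T where "EF H T" by (elim exE conjE)
    then show ?L by (rule exI)
  qed
  show "((\<exists>T. EF H T) \<longleftrightarrow>
      (\<exists>J \<subseteq> components (delete_edges H F). 1 \<le> card J \<and> card J \<le> card F \<and>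
        (\<exists>TJ. TJ \<noteq> {} \<and> EF (induced H (\<Union>C\<in>J. verts C)) TJ) \<and>
        (\<forall>C \<in> components (delete_edges H F) - J. \<exists>TC. EF C TC))) \<and>
    (\<forall>T. EF H T \<longrightarrow>
      (\<exists>J \<subseteq> components (delete_edges H F). 1 \<le> card J \<and> card J \<le> card F \<and>
        (\<exists>TJ TC. TJ \<noteq> {} \<and> EF (induced H (\<Union>C\<in>J. verts C)) TJ \<and>
          (\<forall>C \<in> components (delete_edges H F) - J. EF C (TC C)) \<and>
          card T = card TJ + (\<Sum>C \<in> components (delete_edges H F) - J. card (TC C))))) \<and>
    (\<forall>J \<subseteq> components (delete_edges H F). \<forall>TJ TC.
      1 \<le> card J \<and> card J \<le> card F \<and>
      TJ \<noteq> {} \<and> EF (induced H (\<Union>C\<in>J. verts C)) TJ \<and>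
      (\<forall>C \<in> components (delete_edges H F) - J. EF C (TC C)) \<longrightarrow>
      (\<exists>T. EF H T \<and>
        card T = card TJ + (\<Sum>C \<in> components (delete_edges H F) - J. card (TC C))))"
    by (rule conjI[OF iff conjI])
      ((intro allI impI; rule splits; assumption),
       (intro allI impI; elim conjE; rule glues; assumption))
qed

end
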